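(* Let $k\ge1$ and $t\ge3$ be integers and $n_1\ge n_2\ge\dots\ge n_t\ge1$ integers with $n_1,n_2\ge k^2-k+1$ and such that either $n_3\ge 2k-2$, or $n_3\ge k-1$ and $n_4\ge k-1$. Then $f(K_{n_1,n_2,\dots,n_t},k)=\sum_{i=3}^t n_i-2k+2$.
   Context: $K_{n_1,\dots,n_t}$ is the complete $t$-partite graph with parts of sizes $n_1,\dots,n_t$. For a graph $G$, $f(G,k)$ is the minimum, over all orientations of $G$, of the number of vertices having both indegree at least $k$ and outdegree at least $k$. *)

theory Defs
  imports "Graph_Theory.Graph_Theory"
begin

text \<open>
  As in Graph_Theory, an undirected simple graph is a symmetric loop-free digraph
  (\<^locale>\<open>pair_graph\<close>), so each undirected edge is present as two opposite arcs.
  An orientation keeps exactly one arc of each such pair.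
\<close>

definition orientation_of :: "'a pair_pre_digraph \<Rightarrow> 'a pair_pre_digraph \<Rightarrow> bool" where
  "orientation_of G D \<longleftrightarrow>
     pverts D = pverts G \<and> parcs D \<subseteq> parcs G \<and>
     (\<forall>u v. (u, v) \<in> parcs G \<longrightarrow> ((u, v) \<in> parcs D) \<noteq> ((v, u) \<in> parcs D))"

definition large_degree_verts :: "'a pair_pre_digraph \<Rightarrow> nat \<Rightarrow> 'a set" where
  "large_degree_verts D k =
     {v \<in> pverts D. k \<le> in_degree (with_proj D) v \<and> k \<le> out_degree (with_proj D) v}"

definition min_large_degree :: "'a pair_pre_digraph \<Rightarrow> nat \<Rightarrow> nat" where
  "min_large_degree G k =
     (LEAST m. \<exists>D. orientation_of G D \<and> card (large_degree_verts D k) = m)"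

text \<open>The pair \<open>(i, j)\<close> is the \<open>j\<close>-th vertex of the \<open>i\<close>-th part; both indices start at 1.\<close>

definition complete_multipartite :: "nat \<Rightarrow> (nat \<Rightarrow> nat) \<Rightarrow> (nat \<times> nat) pair_pre_digraph" where
  "complete_multipartite t n =
     \<lparr> pverts = (SIGMA i:{1..t}. {1..n i}),
       parcs = {(u, v). u \<in> (SIGMA i:{1..t}. {1..n i}) \<and>
                        v \<in> (SIGMA i:{1..t}. {1..n i}) \<and> fst u \<noteq> fst v} \<rparr>"

lemma pair_graph_complete_multipartite: "pair_graph (complete_multipartite t n)"
proof -
  let ?V = "SIGMA i:{1..t}. {1..n i}"
  have "finite (parcs (complete_multipartite t n))"
    by (rule finite_subset[of _ "?V \<times> ?V"]) (auto simp: complete_multipartite_def)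
  then show ?thesis
    by unfold_locales
       (auto simp: complete_multipartite_def symmetric_def arcs_ends_def arc_to_ends_def
         with_proj_def sym_def image_iff)
qed

text \<open>
  Every loop-free symmetric digraph has an orientation, so the minimum in
  \<^const>\<open>min_large_degree\<close> is over a nonempty set and is attained.
\<close>

lemma orientation_of_exists:
  assumes "pair_graph G"
  shows "\<exists>D. orientation_of G D"
proof -
  interpret pair_graph G by fact
  obtain r :: "'a rel" where r: "well_order_on UNIV r"
    using well_order_on by blast
  let ?D = "\<lparr> pverts = pverts G, parcs = parcs G \<inter> r \<rparr>"
  have tot: "total_on UNIV r" and anti: "antisym r"
    using r by (auto simp: well_order_on_def linear_order_on_def partial_order_on_def)
  have "((u, v) \<in> parcs ?D) \<noteq> ((v, u) \<in> parcs ?D)" if "(u, v) \<in> parcs G" for u v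
  proof -
    have "(v, u) \<in> parcs G"
      using pair_sym_arcs that by (auto simp: symmetric_def dest: symD)
    moreover have "u \<noteq> v" using pair_no_loops[OF that] by simp
    ultimately show ?thesis
      using that tot anti by (auto simp: total_on_def dest: antisymD)
  qed
  then have "orientation_of G ?D" by (auto simp: orientation_of_def)
  then show ?thesis ..
qed

lemma min_large_degree_attained:
  assumes "pair_graph G"
  shows "\<exists>D. orientation_of G D \<and> card (large_degree_verts D k) = min_large_degree G k"
  unfolding min_large_degree_def
  by (rule LeastI_ex) (use orientation_of_exists[OF assms] in blast)

end

theory Submission
  imports Defs
begin

text \<open>
  A vertex that is not counted has indegree or outdegree at most \<open>d = k - 1\<close>. A set of vertices of
  indegree at most \<open>d\<close> spans at most \<open>d\<close> times its size many edges, which forces it either to have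
  at most \<open>d\<close> vertices outside a single part or to have at most \<open>k\<^sup>2\<close> vertices, and
  \<open>k\<^sup>2 \<le> n\<^sub>2 + d\<close>. So at most \<open>n\<^sub>1 + n\<^sub>2 + 2d\<close> vertices are not counted. For equality,
  choose disjoint sets \<open>P\<close>, \<open>Q\<close> of \<open>d\<close> vertices outside the first two parts
  and orient every edge from left to right in the order \<open>P\<close>, part 1, all other vertices, part 2, \<open>Q\<close>.
\<close>

section \<open>Degrees as sizes of neighbourhoods\<close>

lemma in_degree_with_proj:
  "in_degree (with_proj D) v = card {u. (u, v) \<in> parcs D}"
proof -
  have "in_arcs (with_proj D) v = (\<lambda>u. (u, v)) ` {u. (u, v) \<in> parcs D}"
    by (auto simp: in_arcs_def with_proj_def)
  then show ?thesis
    by (simp add: in_degree_def card_image inj_on_def)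
qed

lemma out_degree_with_proj:
  "out_degree (with_proj D) v = card {u. (v, u) \<in> parcs D}"
proof -
  have "out_arcs (with_proj D) v = (\<lambda>u. (v, u)) ` {u. (v, u) \<in> parcs D}"
    by (auto simp: out_arcs_def with_proj_def)
  then show ?thesis
    by (simp add: out_degree_def card_image inj_on_def)
qed

section \<open>Vertex sets of bounded indegree\<close>

text \<open>Counting arcs inside \<open>A\<close> by their heads gives at most
  \<open>d * card A\<close> arcs. Every ordered pair of differently coloured vertices is such an arc
  or the reversal of one, whence the factor 2.\<close>

lemma card_adjacent_pairs_le:
  assumes fin: "finite A"
    and total: "\<And>u v. u \<in> A \<Longrightarrow> v \<in> A \<Longrightarrow> c u \<noteq> c v \<Longrightarrow> (u, v) \<in> R \<or> (v, u) \<in> R"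
    and deg: "\<And>v. v \<in> A \<Longrightarrow> card {u \<in> A. (u, v) \<in> R} \<le> d"
  shows "card {(u, v). u \<in> A \<and> v \<in> A \<and> c u \<noteq> c v} \<le> 2 * (d * card A)"
proof -
  let ?E = "SIGMA v:A. {u \<in> A. (u, v) \<in> R}"
  have E: "finite ?E" using fin by auto
  have "card ?E = (\<Sum>v\<in>A. card {u \<in> A. (u, v) \<in> R})"
    using fin by (simp add: card_SigmaI)
  also have "\<dots> \<le> card A * d"
    using sum_bounded_above[of A _ d] deg by simp
  finally have cE: "card ?E \<le> card A * d" .
  have "{(u, v). u \<in> A \<and> v \<in> A \<and> c u \<noteq> c v} \<subseteq> ?E \<union> prod.swap ` ?E"
  proof
    fix p assume "p \<in> {(u, v). u \<in> A \<and> v \<in> A \<and> c u \<noteq> c v}"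
    then obtain u v where p: "p = (u, v)" "u \<in> A" "v \<in> A" "c u \<noteq> c v" by auto
    from total[OF p(2-4)] show "p \<in> ?E \<union> prod.swap ` ?E"
      using p by (auto simp: image_iff)
  qed
  then have "card {(u, v). u \<in> A \<and> v \<in> A \<and> c u \<noteq> c v} \<le> card (?E \<union> prod.swap ` ?E)"
    using E by (intro card_mono) auto
  also have "\<dots> \<le> card ?E + card (prod.swap ` ?E)" by (rule card_Un_le)
  also have "\<dots> \<le> card ?E + card ?E" using card_image_le[OF E] by simp
  finally show ?thesis using cE by (simp add: mult.commute)
qed

text \<open>Many vertices spread over several colour classes would span more edges than the
  indegrees permit. If all classes are small, almost every pair is adjacent; if a class
  \<open>X\<close> and its complement \<open>Y\<close> both exceed \<open>d\<close>, the complete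
  bipartite graph between them already has too many edges.\<close>

lemma bounded_degree_multipartite:
  assumes fin: "finite A"
    and total: "\<And>u v. u \<in> A \<Longrightarrow> v \<in> A \<Longrightarrow> c u \<noteq> c v \<Longrightarrow> (u, v) \<in> R \<or> (v, u) \<in> R"
    and deg: "\<And>v. v \<in> A \<Longrightarrow> card {u \<in> A. (u, v) \<in> R} \<le> d"
  shows "(\<exists>i. card {v \<in> A. c v \<noteq> i} \<le> d) \<or> card A \<le> (d + 1)\<^sup>2"
proof (rule disjCI)
  assume "\<not> card A \<le> (d + 1)\<^sup>2"
  then have big: "card A > (d + 1)\<^sup>2" by simp
  let ?P = "{(u, v). u \<in> A \<and> v \<in> A \<and> c u \<noteq> c v}"
  note P_le = card_adjacent_pairs_le[where c = c, OF assms]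
  have fP: "finite ?P" by (rule finite_subset[of _ "A \<times> A"]) (use fin in auto)
  have split: "card A = card {v \<in> A. c v = i} + card {v \<in> A. c v \<noteq> i}" for i
  proof -
    have "A = {v \<in> A. c v = i} \<union> {v \<in> A. c v \<noteq> i}" by auto
    then show ?thesis
      using card_Un_disjoint[of "{v \<in> A. c v = i}" "{v \<in> A. c v \<noteq> i}"] fin by auto
  qed
  have "\<exists>i. card {v \<in> A. c v = i} > d"
  proof (rule ccontr)
    assume le: "\<not> ?thesis"
    then have small: "card A - d \<le> card {v \<in> A. c v \<noteq> i}" for i
    proof -
      have "card {v \<in> A. c v = i} \<le> d" using le by (simp add: not_less)
      then show ?thesis using split[of i] by linarith
    qed
    \<comment> \<open>With all classes of size at most \<open>d\<close>, each vertex has at least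
      \<open>card A - d\<close> partners of another colour.\<close>
    have "card A * (card A - d) \<le> (\<Sum>u\<in>A. card {v \<in> A. c v \<noteq> c u})"
      using sum_bounded_below[of A "card A - d" "\<lambda>u. card {v \<in> A. c v \<noteq> c u}"] small by simp
    also have "\<dots> = card (SIGMA u:A. {v \<in> A. c v \<noteq> c u})"
      using fin by (simp add: card_SigmaI)
    also have "(SIGMA u:A. {v \<in> A. c v \<noteq> c u}) = ?P" by auto
    finally have "card A * (card A - d) \<le> card A * (2 * d)"
      using P_le by (simp add: algebra_simps)
    moreover have "card A > 0" using big by linarith
    ultimately have "card A - d \<le> 2 * d" by (simp only: mult_le_cancel1)
    then have "card A \<le> 3 * d" by linarith
    moreover have "3 * d \<le> (d + 1)\<^sup>2"
      by (cases d) (simp_all add: power2_eq_square)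
    ultimately show False using big by simp
  qed
  then obtain i where i: "card {v \<in> A. c v = i} > d" ..
  define X where "X = {v \<in> A. c v = i}"
  define Y where "Y = {v \<in> A. c v \<noteq> i}"
  have XY: "finite X" "finite Y" "card A = card X + card Y"
    using fin split[of i] by (auto simp: X_def Y_def)
  have "card Y \<le> d"
  proof (rule ccontr)
    assume "\<not> card Y \<le> d"
    then obtain y where y: "card Y = d + 1 + y"
      using le_Suc_ex[of "d + 1" "card Y"] by auto
    obtain x where x: "card X = d + 1 + x"
      using i le_Suc_ex[of "d + 1" "card X"] by (auto simp: X_def)
    have "2 * (card X * card Y) = card (X \<times> Y \<union> Y \<times> X)"
      using XY by (subst card_Un_disjoint) (auto simp: X_def Y_def card_cartesian_product)
    also have "\<dots> \<le> card ?P"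
      by (rule card_mono[OF fP]) (auto simp: X_def Y_def)
    finally have "card X * card Y \<le> d * (card X + card Y)"
      using P_le XY by simp
    \<comment> \<open>The edge count amounts to
      \<open>(card X - d) * (card Y - d) \<le> d * d\<close>, that is
      \<open>(x + 1) * (y + 1) \<le> d * d\<close>; dropping the product \<open>x * y\<close> leaves
      this. It yields \<open>card A = 2 * d + 2 + x + y \<le> (d + 1)^2\<close>.\<close>
    then have "x + y + 1 \<le> d * d"
      by (simp add: x y algebra_simps)
    then show False
      using big XY x y by (simp add: power2_eq_square)
  qed
  then show "\<exists>i. card {v \<in> A. c v \<noteq> i} \<le> d" by (auto simp: Y_def)
qed

section \<open>Lower bound for every orientation\<close>

text \<open>A set of the first kind is one part plus at most \<open>d\<close> further vertices. Two
  such sets cover at most two parts, which hold at most \<open>n 1 + n 2\<close> vertices. A set of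
  the second kind has at most \<open>n 2 + d\<close> vertices, while the other set always has at
  most \<open>n 1 + d\<close>.\<close>

lemma card_bounded_degree_union_le:
  fixes n :: "nat \<Rightarrow> nat"
  assumes t: "t \<ge> 2"
    and mono: "\<And>i j. 1 \<le> i \<Longrightarrow> i \<le> j \<Longrightarrow> j \<le> t \<Longrightarrow> n j \<le> n i"
    and n2: "(d + 1)\<^sup>2 \<le> n 2 + d"
    and AV: "A \<subseteq> (SIGMA i:{1..t}. {1..n i})" and BV: "B \<subseteq> (SIGMA i:{1..t}. {1..n i})"
    and A: "(\<exists>i. card {v \<in> A. fst v \<noteq> i} \<le> d) \<or> card A \<le> (d + 1)\<^sup>2"
    and B: "(\<exists>i. card {v \<in> B. fst v \<noteq> i} \<le> d) \<or> card B \<le> (d + 1)\<^sup>2"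
  shows "card (A \<union> B) \<le> n 1 + n 2 + 2 * d"
proof -
  let ?V = "SIGMA i:{1..t}. {1..n i}"
  let ?W = "\<lambda>i. {v \<in> ?V. fst v = i}"
  have fin: "finite A" "finite B"
    using finite_subset[OF AV] finite_subset[OF BV] by auto
  have n21: "n 2 \<le> n 1" using mono[of 1 2] t by simp
  \<comment> \<open>The index \<open>i\<close> supplied by the hypotheses on \<open>A\<close> and
    \<open>B\<close> is an arbitrary number; outside \<open>{1..t}\<close> it denotes an empty
    part.\<close>
  have W: "card (?W i) = (if i \<in> {1..t} then n i else 0)" for i
  proof -
    have "?W i = (if i \<in> {1..t} then {i} \<times> {1..n i} else {})" by auto
    then show ?thesis by (simp add: card_cartesian_product)
  qed
  have W1: "card (?W i) \<le> n 1" for i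
    unfolding W using mono[of 1 i] by auto
  have W2: "card (?W i) + card (?W j) \<le> n 1 + n 2" if "i < j" for i j
    unfolding W using that mono[of 1 i] mono[of 1 j] mono[of 2 j] by auto
  have WW: "card (?W i \<union> ?W j) \<le> n 1 + n 2" for i j
  proof (cases i j rule: linorder_cases)
    case equal
    then show ?thesis using W1[of i] by simp
  next
    case less
    then show ?thesis using W2[of i j] card_Un_le[of "?W i" "?W j"] by linarith
  next
    case greater
    then show ?thesis using W2[of j i] card_Un_le[of "?W i" "?W j"] by linarith
  qed
  have le1: "card S \<le> n 1 + d"
    if S: "S \<subseteq> ?V" "(\<exists>i. card {v \<in> S. fst v \<noteq> i} \<le> d) \<or> card S \<le> (d + 1)\<^sup>2" for S
    using S(2)
  proof
    assume "\<exists>i. card {v \<in> S. fst v \<noteq> i} \<le> d"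
    then obtain i where i: "card {v \<in> S. fst v \<noteq> i} \<le> d" ..
    have "card S \<le> card (?W i \<union> {v \<in> S. fst v \<noteq> i})"
      using S(1) finite_subset[OF S(1)] by (intro card_mono) auto
    also have "\<dots> \<le> card (?W i) + card {v \<in> S. fst v \<noteq> i}" by (rule card_Un_le)
    finally show ?thesis using i W1[of i] by linarith
  qed (use n2 n21 in linarith)
  show ?thesis
  proof (cases "card A \<le> (d + 1)\<^sup>2 \<or> card B \<le> (d + 1)\<^sup>2")
    case True
    then show ?thesis
      using le1[OF AV A] le1[OF BV B] card_Un_le[of A B] n2 by linarith
  next
    case False
    then obtain i j where ij: "card {v \<in> A. fst v \<noteq> i} \<le> d" "card {v \<in> B. fst v \<noteq> j} \<le> d"
      using A B by auto
    have "card (A \<union> B) \<le> card ((?W i \<union> ?W j) \<union> ({v \<in> A. fst v \<noteq> i} \<union> {v \<in> B. fst v \<noteq> j}))"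
      using AV BV fin by (intro card_mono) auto
    also have "\<dots> \<le> card (?W i \<union> ?W j) + (card {v \<in> A. fst v \<noteq> i} + card {v \<in> B. fst v \<noteq> j})"
      by (meson card_Un_le add_left_mono order_trans)
    finally show ?thesis using ij WW[of i j] by linarith
  qed
qed

text \<open>The counted vertices together with the sets \<open>A\<close> and \<open>B\<close> of
  small indegree and small outdegree cover all vertices. The additive form avoids truncated
  subtraction.\<close>

lemma card_large_degree_verts_ge:
  fixes n :: "nat \<Rightarrow> nat"
  assumes t: "t \<ge> 2"
    and mono: "\<And>i j. 1 \<le> i \<Longrightarrow> i \<le> j \<Longrightarrow> j \<le> t \<Longrightarrow> n j \<le> n i"
    and n2: "(d + 1)\<^sup>2 \<le> n 2 + d"
    and D: "orientation_of (complete_multipartite t n) D"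
  shows "(\<Sum>i=1..t. n i) \<le> card (large_degree_verts D (d + 1)) + (n 1 + n 2 + 2 * d)"
proof -
  let ?V = "SIGMA i:{1..t}. {1..n i}"
  let ?L = "large_degree_verts D (d + 1)"
  define A where "A = {v \<in> ?V. card {u. (u, v) \<in> parcs D} \<le> d}"
  define B where "B = {v \<in> ?V. card {u. (v, u) \<in> parcs D} \<le> d}"
  note D = D[unfolded orientation_of_def complete_multipartite_def pair_pre_digraph.simps]
  have V: "pverts D = ?V" using D by blast
  have sub: "parcs D \<subseteq> ?V \<times> ?V" using D by blast
  have tot: "(u, v) \<in> parcs D \<or> (v, u) \<in> parcs D" if "u \<in> ?V" "v \<in> ?V" "fst u \<noteq> fst v" for u v
    using D that by blast
  have finV: "finite ?V" by simp
  have AV: "A \<subseteq> ?V" and BV: "B \<subseteq> ?V" by (auto simp: A_def B_def)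
  have finN: "finite {u. (u, v) \<in> parcs D}" "finite {u. (v, u) \<in> parcs D}" for v
    by (rule finite_subset[OF _ finV], use sub in blast)+
  have A: "(\<exists>i. card {v \<in> A. fst v \<noteq> i} \<le> d) \<or> card A \<le> (d + 1)\<^sup>2"
  proof (rule bounded_degree_multipartite[where R = "parcs D"])
    show "finite A" by (rule finite_subset[OF AV finV])
    show "(u, v) \<in> parcs D \<or> (v, u) \<in> parcs D" if "u \<in> A" "v \<in> A" "fst u \<noteq> fst v" for u v
      using tot that AV by blast
    show "card {u \<in> A. (u, v) \<in> parcs D} \<le> d" if "v \<in> A" for v
      using that card_mono[OF finN(1)[of v], of "{u \<in> A. (u, v) \<in> parcs D}"]
      by (force simp: A_def)
  qed
  have B: "(\<exists>i. card {v \<in> B. fst v \<noteq> i} \<le> d) \<or> card B \<le> (d + 1)\<^sup>2"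
  \<comment> \<open>Reversing all arcs turns the outdegree bound into an indegree bound.\<close>
  proof (rule bounded_degree_multipartite[where R = "(parcs D)\<inverse>"])
    show "finite B" by (rule finite_subset[OF BV finV])
    show "(u, v) \<in> (parcs D)\<inverse> \<or> (v, u) \<in> (parcs D)\<inverse>" if "u \<in> B" "v \<in> B" "fst u \<noteq> fst v" for u v
      using tot that BV by blast
    show "card {u \<in> B. (u, v) \<in> (parcs D)\<inverse>} \<le> d" if "v \<in> B" for v
      using that card_mono[OF finN(2)[of v], of "{u \<in> B. (v, u) \<in> parcs D}"]
      by (force simp: B_def)
  qed
  have "?V \<subseteq> ?L \<union> (A \<union> B)"
    by (auto simp: large_degree_verts_def in_degree_with_proj out_degree_with_proj V A_def B_def)
  moreover have "finite (?L \<union> (A \<union> B))"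
    by (rule finite_subset[OF _ finV]) (use AV BV V in \<open>auto simp: large_degree_verts_def\<close>)
  ultimately have "card ?V \<le> card (?L \<union> (A \<union> B))" by (rule card_mono[rotated])
  also have "\<dots> \<le> card ?L + card (A \<union> B)" by (rule card_Un_le)
  finally show ?thesis
    using card_bounded_degree_union_le[OF t mono n2 AV BV A B] by simp
qed

section \<open>An orientation attaining the bound\<close>

lemma ex_orientation_card_large_degree_verts_le:
  fixes n :: "nat \<Rightarrow> nat"
  assumes S: "2 * d \<le> (\<Sum>i=3..t. n i)"
  shows "\<exists>D. orientation_of (complete_multipartite t n) D \<and>
    card (large_degree_verts D (d + 1)) \<le> (\<Sum>i=3..t. n i) - 2 * d"
proof -
  let ?V = "SIGMA i:{1..t}. {1..n i}"
  let ?U = "SIGMA i:{3..t}. {1..n i}"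
  have U: "finite ?U" "card ?U = (\<Sum>i=3..t. n i)" by simp_all
  obtain P where P: "P \<subseteq> ?U" "card P = d" "finite P"
    using obtain_subset_with_card_n[of d ?U] S U by (metis le_add1 mult_2 order_trans)
  have "card (?U - P) = (\<Sum>i=3..t. n i) - d" using P U by (simp add: card_Diff_subset)
  then obtain Q where Q: "Q \<subseteq> ?U - P" "card Q = d" "finite Q"
    using obtain_subset_with_card_n[of d "?U - P"] S by (metis add_le_imp_le_diff mult_2)
  \<comment> \<open>The ranks 0 to 4 encode the order \<open>P\<close>, part 1, the rest, part 2,
    \<open>Q\<close>. Edges between vertices of equal rank are directed by part number.\<close>
  define r :: "nat \<times> nat \<Rightarrow> nat" where
    "r v = (if v \<in> P then 0 else if v \<in> Q then 4 else if fst v = 1 then 1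
            else if fst v = 2 then 3 else 2)" for v
  define D where "D = \<lparr>pverts = ?V,
    parcs = {(u, v). u \<in> ?V \<and> v \<in> ?V \<and> (r u < r v \<and> fst u \<noteq> fst v \<or> r u = r v \<and> fst u < fst v)}\<rparr>"
  have arc_iff: "(u, v) \<in> parcs D \<longleftrightarrow> u \<in> ?V \<and> v \<in> ?V \<and>
      (r u < r v \<and> fst u \<noteq> fst v \<or> r u = r v \<and> fst u < fst v)" for u v
    by (simp only: D_def pair_pre_digraph.simps mem_Collect_eq prod.case)
  have "orientation_of (complete_multipartite t n) D"
    by (auto simp: orientation_of_def complete_multipartite_def D_def)
  moreover have "large_degree_verts D (d + 1) \<subseteq> ?U - P - Q"
  proof
    fix v assume v: "v \<in> large_degree_verts D (d + 1)"
    then have vV: "v \<in> ?V"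
      and ind: "d < card {u. (u, v) \<in> parcs D}" and outd: "d < card {u. (v, u) \<in> parcs D}"
      by (auto simp: large_degree_verts_def in_degree_with_proj out_degree_with_proj D_def)
    have arc: "r u < r w \<or> r u = r w \<and> fst u < fst w" if "(u, w) \<in> parcs D" for u w
      using that unfolding arc_iff by blast
    have r_cases: "u \<in> P \<and> r u = 0 \<or> u \<in> Q \<and> r u = 4 \<or> fst u = 1 \<and> r u = 1 \<or> fst u = 2 \<and> r u = 3
      \<or> u \<notin> P \<and> u \<notin> Q \<and> fst u \<noteq> 1 \<and> fst u \<noteq> 2 \<and> r u = 2" for u
      by (cases "u \<in> P"; cases "u \<in> Q"; cases "fst u = 1"; cases "fst u = 2") (simp_all add: r_def)
    \<comment> \<open>All in-neighbours of a vertex of rank 0 or 1 lie in \<open>P\<close>, because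
      rank 1 occurs only inside part 1, which spans no edge. Since \<open>card P = d\<close>, a
      counted vertex has rank above 1. Dually, \<open>Q\<close> contains all out-neighbours of
      vertices of rank 3 or 4.\<close>
    have "\<not> {u. (u, v) \<in> parcs D} \<subseteq> P"
      using card_mono[OF P(3)] ind P(2) by (meson leD)
    then obtain u where u: "(u, v) \<in> parcs D" "u \<notin> P" by blast
    then have "fst u \<noteq> 0" unfolding arc_iff by fastforce
    then have "r v > 1" using arc[OF u(1)] u(2) r_cases[of u] r_cases[of v] by linarith
    have "\<not> {u. (v, u) \<in> parcs D} \<subseteq> Q"
      using card_mono[OF Q(3)] outd Q(2) by (meson leD)
    then obtain w where w: "(v, w) \<in> parcs D" "w \<notin> Q" by blast
    then have "r v < 3" using arc[OF w(1)] r_cases[of v] r_cases[of w] by linarith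
    with \<open>r v > 1\<close> have "r v = 2" by linarith
    then have "v \<notin> P" "v \<notin> Q" "fst v \<noteq> 1" "fst v \<noteq> 2"
      using r_cases[of v] by (elim disjE conjE; simp)+
    then show "v \<in> ?U - P - Q" using vV by auto
  qed
  then have "card (large_degree_verts D (d + 1)) \<le> card (?U - P - Q)"
    using U by (intro card_mono) auto
  moreover have "card (?U - P - Q) = (\<Sum>i=3..t. n i) - 2 * d"
    using P Q U by (simp add: card_Diff_subset)
  ultimately show ?thesis by auto
qed

theorem theorem7:
  fixes k t :: nat and n :: "nat \<Rightarrow> nat"
  assumes "k \<ge> 1" and "t \<ge> 3"
    and "\<forall>i\<in>{1..t}. \<forall>j\<in>{1..t}. i \<le> j \<longrightarrow> n i \<ge> n j" and "n t \<ge> 1"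
    and "int (n 1) \<ge> (int k)^2 - int k + 1" and "int (n 2) \<ge> (int k)^2 - int k + 1"
    and "int (n 3) \<ge> 2 * int k - 2 \<or>
         t \<ge> 4 \<and> int (n 3) \<ge> int k - 1 \<and> int (n 4) \<ge> int k - 1"
  shows "int (min_large_degree (complete_multipartite t n) k) =
         (\<Sum>i=3..t. int (n i)) - 2 * int k + 2"
proof -
  define d where "d = k - 1"
  have k: "k = d + 1" using assms(1) by (simp add: d_def)
  let ?S = "\<Sum>i=3..t. n i"
  \<comment> \<open>In terms of \<open>d\<close>, the bound \<open>k^2 - k + 1\<close> equals
    \<open>(d + 1)^2 - d\<close>.\<close>
  have "int ((d + 1)\<^sup>2) \<le> int (n 2 + d)"
    using assms(6) by (simp add: k power2_eq_square algebra_simps)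
  then have n2: "(d + 1)\<^sup>2 \<le> n 2 + d" by linarith
  have mono: "n j \<le> n i" if "1 \<le> i" "i \<le> j" "j \<le> t" for i j
    using assms(3) that by simp
  \<comment> \<open>This is the room for the disjoint sets \<open>P\<close> and \<open>Q\<close>:
    part 3 alone, or parts 3 and 4 with \<open>d\<close> vertices each. It also makes the
    natural-number difference \<open>?S - 2 * d\<close> exact at the end.\<close>
  have S: "2 * d \<le> ?S"
    using assms(7)
  proof
    assume "int (n 3) \<ge> 2 * int k - 2"
    moreover have "n 3 \<le> ?S" using assms(2) by (intro member_le_sum) auto
    ultimately show ?thesis by (simp add: k)
  next
    assume "t \<ge> 4 \<and> int (n 3) \<ge> int k - 1 \<and> int (n 4) \<ge> int k - 1"
    moreover from this have "sum n {3, 4} \<le> ?S" by (intro sum_mono2) auto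
    ultimately show ?thesis by (simp add: k)
  qed
  have total: "(\<Sum>i=1..t. n i) = n 1 + n 2 + ?S"
  proof -
    have "{1..t} = insert 1 (insert 2 {3..t})" using assms(2) by auto
    then show ?thesis by simp
  qed
  have "min_large_degree (complete_multipartite t n) k \<le> ?S - 2 * d"
  proof -
    obtain D where D: "orientation_of (complete_multipartite t n) D"
      "card (large_degree_verts D k) \<le> ?S - 2 * d"
      using ex_orientation_card_large_degree_verts_le[OF S] k by auto
    have "min_large_degree (complete_multipartite t n) k \<le> card (large_degree_verts D k)"
      unfolding min_large_degree_def by (rule Least_le) (use D(1) in blast)
    then show ?thesis using D(2) by linarith
  qed
  moreover have "?S \<le> min_large_degree (complete_multipartite t n) k + 2 * d"
  proof -
    obtain D where D: "orientation_of (complete_multipartite t n) D"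
      "card (large_degree_verts D k) = min_large_degree (complete_multipartite t n) k"
      using min_large_degree_attained[OF pair_graph_complete_multipartite] by blast
    show ?thesis
      using card_large_degree_verts_ge[OF _ mono n2 D(1)] assms(2) D(2) total k by simp
  qed
  ultimately have "int (min_large_degree (complete_multipartite t n) k) = int ?S - 2 * int d"
    using S by linarith
  then show ?thesis by (simp add: k)
qed

end
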